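(* Let $f$ be any one of the three functions on $(0,1]^2$ (i) $f(p,q)=c_1p^2q\,e^{-c_2qp}-p$ with $c_1,c_2>0$ (overlay D2D with probabilistic mode selection), (ii) $f(p,q)=c_1p^2q\,e^{-c_2qp^2}-p$ with $c_1,c_2>0$ (overlay D2D with distance-based mode selection), (iii) $f(p,q)=\bar c_1pq\,e^{-(\bar c_2qp^2+\bar c_3qp)}-p$ with $\bar c_1,\bar c_2,\bar c_3>0$ (underlay D2D with distance-based mode selection). If the parameters belong to the D2D operational region, i.e. there exists $(p,q)\in(0,1]^2$ with $f(p,q)>0$, then the maximum over $(p,q)\in(0,1]^2$ of the average user rate $R$ is not achieved at any point $(p^*,q^* )\in(0,1)^2$.
   Context: A D2D-enabled cellular network has D2D mode selection probability $p\in(0,1]$ and D2D channel access probability $q\in(0,1]$. Its average user rate is $R=R_{\mathrm{noD2D}}(1+w f(p,q))$, where $R_{\mathrm{noD2D}}>0$ (the rate without D2D) and $w>0$ do not depend on $(p,q)$; hence maximizing $R$ over $(p,q)$ is the same as maximizing $f$. The positive constants $c_1,c_2$ (overlay) and $\bar c_1,\bar c_2,\bar c_3$ (underlay) encode the operational point of the system, and the D2D operational region is the set of such constants for which some $(p,q)\in(0,1]^2$ gives $R>R_{\mathrm{noD2D}}$, i.e. $f(p,q)>0$. *)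

theory Defs
  imports Complex_Main
begin

text \<open>
  The first argument is the mode selection probability \<open>p\<close>, the second the channel access
  probability \<open>q\<close>. Only the values on \<open>admissible\<close> matter.
\<close>

definition admissible :: "(real \<times> real) set" where
  "admissible = {0<..1} \<times> {0<..1}"

definition f_overlay_prob :: "real \<Rightarrow> real \<Rightarrow> real \<Rightarrow> real \<Rightarrow> real" where
  "f_overlay_prob c1 c2 p q = c1 * p^2 * q * exp (- (c2 * q * p)) - p"

definition f_overlay_dist :: "real \<Rightarrow> real \<Rightarrow> real \<Rightarrow> real \<Rightarrow> real" where
  "f_overlay_dist c1 c2 p q = c1 * p^2 * q * exp (- (c2 * q * p^2)) - p"

definition f_underlay_dist :: "real \<Rightarrow> real \<Rightarrow> real \<Rightarrow> real \<Rightarrow> real \<Rightarrow> real" where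
  "f_underlay_dist c1 c2 c3 p q = c1 * p * q * exp (- (c2 * q * p^2 + c3 * q * p)) - p"

definition avg_rate :: "real \<Rightarrow> real \<Rightarrow> (real \<Rightarrow> real \<Rightarrow> real) \<Rightarrow> real \<Rightarrow> real \<Rightarrow> real" where
  "avg_rate R_noD2D w f p q = R_noD2D * (1 + w * f p q)"

text \<open>
  For \<open>R_noD2D, w > 0\<close> the condition \<open>f p q > 0\<close> says that \<open>avg_rate R_noD2D w f p q > R_noD2D\<close>.
  The parameters enter through \<open>f\<close>: they belong to the operational region iff this holds
  for the resulting function.
\<close>

definition in_operational_region :: "(real \<Rightarrow> real \<Rightarrow> real) \<Rightarrow> bool" where
  "in_operational_region f \<longleftrightarrow> (\<exists>(p, q) \<in> admissible. f p q > 0)"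

end

theory Submission
  imports Defs
begin

text \<open>
  A point with \<open>f > 0\<close> and \<open>p, q < 1\<close> is beaten by moving to the boundary along a curve on which
  the exponent is under control. In case (i), with \<open>p q\<close> fixed, \<open>f\<close> is a positive multiple of
  \<open>p\<close>, so \<open>p = 1\<close> is better. In case (ii), with \<open>q p\<^sup>2\<close> fixed, \<open>f\<close> is a constant minus \<open>p\<close>, and in
  case (iii), with \<open>p q\<close> fixed, \<open>f\<close> is strictly decreasing in \<open>p\<close>, so in both cases \<open>q = 1\<close> is
  better.
\<close>

lemma f_overlay_prob_less:
  assumes "p < 1" "0 < p" "f_overlay_prob c1 c2 p q > 0"
  shows "f_overlay_prob c1 c2 p q < f_overlay_prob c1 c2 1 (p * q)"
proof -
  define B where "B = c1 * (p * q) * exp (- (c2 * (p * q))) - 1"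
  have eq: "f_overlay_prob c1 c2 p q = p * B" "f_overlay_prob c1 c2 1 (p * q) = B"
    by (simp_all add: f_overlay_prob_def B_def power2_eq_square algebra_simps)
  \<comment> \<open>Positivity of \<open>f\<close> fixes the sign of \<open>B\<close>; then
    \<open>p < 1\<close> gives \<open>p * B < B\<close>.\<close>
  have "B > 0"
    using assms eq by (simp add: zero_less_mult_iff)
  then show ?thesis
    using assms eq by simp
qed

lemma f_overlay_dist_less:
  assumes "0 < p" "0 < q" "q < 1"
  shows "f_overlay_dist c1 c2 p q < f_overlay_dist c1 c2 (p * sqrt q) 1"
proof -
  \<comment> \<open>\<open>(p * sqrt q)^2 = q * p^2\<close>, so only the subtracted term
    changes.\<close>
  have "p * sqrt q < p"
    using assms by simp
  then show ?thesis
    using assms by (simp add: f_overlay_dist_def power_mult_distrib algebra_simps)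
qed

lemma f_underlay_dist_less:
  assumes "0 < p" "0 < q" "q < 1" "0 < c1" "0 < c2"
  shows "f_underlay_dist c1 c2 c3 p q < f_underlay_dist c1 c2 c3 (p * q) 1"
proof -
  have "p * q < p"
    using assms by simp
  \<comment> \<open>The \<open>c2\<close> term shrinks by the factor \<open>q\<close>; the
    \<open>c3\<close> term is unchanged.\<close>
  moreover have "(p * q) * (p * q) \<le> (p * q) * p"
    using assms by (intro mult_left_mono) auto
  then have "c2 * (p * q)^2 + c3 * (p * q) \<le> c2 * q * p^2 + c3 * q * p"
    using assms by (simp add: power2_eq_square mult_ac)
  then have "c1 * p * q * exp (- (c2 * q * p^2 + c3 * q * p))
      \<le> c1 * p * q * exp (- (c2 * (p * q)^2 + c3 * (p * q)))"
    using assms by (intro mult_left_mono) auto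
  ultimately show ?thesis
    by (simp add: f_underlay_dist_def mult.assoc)
qed

theorem proposition3:
  fixes f :: "real \<Rightarrow> real \<Rightarrow> real" and R_noD2D w :: real
  assumes "R_noD2D > 0" and "w > 0"
    and "(\<exists>c1 c2. c1 > 0 \<and> c2 > 0 \<and> f = f_overlay_prob c1 c2) \<or>
         (\<exists>c1 c2. c1 > 0 \<and> c2 > 0 \<and> f = f_overlay_dist c1 c2) \<or>
         (\<exists>c1 c2 c3. c1 > 0 \<and> c2 > 0 \<and> c3 > 0 \<and> f = f_underlay_dist c1 c2 c3)"
    and "in_operational_region f"
  shows "\<not> (\<exists>(p, q) \<in> {0<..<1} \<times> {0<..<1}.
            is_arg_max (\<lambda>(p, q). avg_rate R_noD2D w f p q) (\<lambda>x. x \<in> admissible) (p, q))"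
proof
  assume "\<exists>(p, q) \<in> {0<..<1} \<times> {0<..<1}.
            is_arg_max (\<lambda>(p, q). avg_rate R_noD2D w f p q) (\<lambda>x. x \<in> admissible) (p, q)"
  then obtain p q where pq: "0 < p" "p < 1" "0 < q" "q < 1"
    and "is_arg_max (\<lambda>(p, q). avg_rate R_noD2D w f p q) (\<lambda>x. x \<in> admissible) (p, q)"
    by auto
  \<comment> \<open>The rate is affine and increasing in \<open>f\<close>.\<close>
  then have max: "f p' q' \<le> f p q" if "(p', q') \<in> admissible" for p' q'
    using that assms(1,2) by (fastforce simp: is_arg_max_linorder avg_rate_def)
  \<comment> \<open>A maximum is at least the positive value that the operational region
    provides.\<close>
  have pos: "f p q > 0"
    using assms(4) max unfolding in_operational_region_def by fastforce
  have "p * q < 1" "p * sqrt q < 1"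
    using pq mult_strict_mono[of p 1 q 1] mult_strict_mono[of p 1 "sqrt q" 1] by auto
  then have adm: "(1, p * q) \<in> admissible" "(p * q, 1) \<in> admissible"
    "(p * sqrt q, 1) \<in> admissible"
    using pq by (auto simp: admissible_def)
  from assms(3) have "\<exists>(p', q') \<in> admissible. f p q < f p' q'"
    using adm pq pos f_overlay_prob_less f_overlay_dist_less f_underlay_dist_less by blast
  then show False
    using max by fastforce
qed

end
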